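(* Let $(G,X)$ be a distal flow with $G$ compactly generated, such that $\dim\overline{Gx}=0$ for all $x\in X$, where $X$ need not be locally compact. Then, under the discrete topology of $G$, $(G,X)$ is pointwise regularly almost periodic, and $(G,\overline{Gx})$ is a regularly almost periodic subflow for every $x\in X$.
   Context: A Hausdorff para-topological group is a group with a Hausdorff topology for which multiplication $G\times G\to G$ is jointly continuous (inversion need not be continuous). Here a flow $(G,X)$ consists of a Hausdorff para-topological group $G$, a Hausdorff uniform space $X$ (uniformity $\mathscr{U}$; local compactness is not required in this statement), and a jointly continuous map $G\times X\to X$, $(t,x)\mapsto tx$, with $ex=x$ and $(st)x=s(tx)$, such that $\overline{Gx}$ is compact for every $x\in X$. $G$ is compactly generated if there is a compact $\Gamma\subseteq G$ with $e\in\Gamma=\Gamma^{-1}$ and $G=\bigcup_{r\ge1}\Gamma^r$. A Hausdorff space $Y$ has $\dim Y=0$ if it has a base of clopen sets. $(G,X)$ is distal if for all $x\ne y$ in $X$ the closure of $\{(gx,gy):g\in G\}$ in $X\times X$ is disjoint from the diagonal. Under the discrete topology of $G$, a subset $A\subseteq G$ is syndetic if $G=K^{-1}A$ for some finite $K\subseteq G$. A point $x$ is regularly almost periodic if for every neighborhood $U$ of $x$ the set $\{t\in G:tx\in U\}$ contains a syndetic normal subgroup of $G$; pointwise regularly almost periodic means every point is regularly almost periodic. A flow $(G,Y)$ is (uniformly) regularly almost periodic if for every index $\alpha$ of the uniformity of $Y$ there is a syndetic normal subgroup $A$ of $G$ with $Ay\subseteq\alpha[y]$ for all $y\in Y$,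 where $\alpha[y]=\{z:(y,z)\in\alpha\}$. *)

theory Defs
  imports "HOL-Analysis.Analysis" "HOL-Library.Set_Algebras"
begin

text \<open>
  Groups are written additively, following the library classes: the class \<open>group_add\<close> does
  not assume commutativity, and \<open>topological_monoid_add\<close> adds joint continuity of the
  operation but says nothing about inversion, so the sort
  \<open>{group_add, topological_monoid_add, t2_space}\<close> is that of Hausdorff para-topological
  groups.  On sets, \<open>+\<close> is the elementwise sum of \<open>Set_Algebras\<close>.
\<close>

locale flow =
  fixes act :: "'g::{group_add, topological_monoid_add, t2_space} \<Rightarrow>
                'x::{uniform_space, t2_space} \<Rightarrow> 'x"
  assumes continuous_act: "continuous_on UNIV (\<lambda>(t, x). act t x)"
    and act_zero: "act 0 x = x"
    and act_add: "act (s + t) x = act s (act t x)"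
    and compact_orbit_closure: "compact (closure (range (\<lambda>t. act t x)))"

abbreviation orbit_closure :: "('g \<Rightarrow> 'x \<Rightarrow> 'x::topological_space) \<Rightarrow> 'x \<Rightarrow> 'x set" where
  "orbit_closure act x \<equiv> closure (range (\<lambda>t. act t x))"

text \<open>
  The set \<open>((+) \<Gamma> ^^ r) {0}\<close> is the \<open>r\<close>-fold sum \<open>\<Gamma> + \<dots> + \<Gamma>\<close>,
  written \<open>\<Gamma>\<close> to the power \<open>r\<close> in multiplicative notation.
\<close>

definition compactly_generated ::
    "'g::{group_add, topological_monoid_add, t2_space} itself \<Rightarrow> bool" where
  "compactly_generated (_ :: 'g itself) \<longleftrightarrow>
     (\<exists>\<Gamma>::'g set. compact \<Gamma> \<and> 0 \<in> \<Gamma> \<and> \<Gamma> = uminus ` \<Gamma> \<and>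
        UNIV = (\<Union>r\<in>{1..}. ((+) \<Gamma> ^^ r) {0}))"

definition zero_dimensional_space :: "'a topology \<Rightarrow> bool" where
  "zero_dimensional_space T \<longleftrightarrow> Hausdorff_space T \<and>
     (\<exists>\<B>. (\<forall>B\<in>\<B>. openin T B \<and> closedin T B) \<and>
          (\<forall>U. openin T U \<longrightarrow> (\<exists>\<C>\<subseteq>\<B>. U = \<Union>\<C>)))"

definition distal :: "('g \<Rightarrow> 'x \<Rightarrow> 'x::topological_space) \<Rightarrow> bool" where
  "distal act \<longleftrightarrow>
     (\<forall>x y. x \<noteq> y \<longrightarrow> closure (range (\<lambda>g. (act g x, act g y))) \<inter> Id = {})"

definition normal_subgroup :: "'g::group_add set \<Rightarrow> bool" where
  "normal_subgroup A \<longleftrightarrow>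
     0 \<in> A \<and> (\<forall>a\<in>A. \<forall>b\<in>A. a + b \<in> A) \<and> (\<forall>a\<in>A. - a \<in> A) \<and>
     (\<forall>g. \<forall>a\<in>A. g + a - g \<in> A)"

text \<open>Syndetic with respect to the discrete topology of the group.\<close>

definition syndetic :: "'g::group_add set \<Rightarrow> bool" where
  "syndetic A \<longleftrightarrow> (\<exists>K. finite K \<and> UNIV = uminus ` K + A)"

definition regularly_almost_periodic_point ::
    "('g::group_add \<Rightarrow> 'x \<Rightarrow> 'x::topological_space) \<Rightarrow> 'x \<Rightarrow> bool" where
  "regularly_almost_periodic_point act x \<longleftrightarrow>
     (\<forall>U. (\<forall>\<^sub>F y in nhds x. y \<in> U) \<longrightarrow>
        (\<exists>A. normal_subgroup A \<and> syndetic A \<and> A \<subseteq> {t. act t x \<in> U}))"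

definition pointwise_regularly_almost_periodic ::
    "('g::group_add \<Rightarrow> 'x \<Rightarrow> 'x::topological_space) \<Rightarrow> bool" where
  "pointwise_regularly_almost_periodic act \<longleftrightarrow> (\<forall>x. regularly_almost_periodic_point act x)"

definition subflow :: "('g \<Rightarrow> 'x \<Rightarrow> 'x::topological_space) \<Rightarrow> 'x set \<Rightarrow> bool" where
  "subflow act Y \<longleftrightarrow> Y \<noteq> {} \<and> closed Y \<and> (\<forall>t. \<forall>y\<in>Y. act t y \<in> Y)"

text \<open>
  Uniform regular almost periodicity of the restriction to an invariant set \<open>Y\<close>; the indices
  range over the uniformity induced on \<open>Y\<close>.
\<close>

definition regularly_almost_periodic_on ::
    "('g::group_add \<Rightarrow> 'x \<Rightarrow> 'x::uniform_space) \<Rightarrow> 'x set \<Rightarrow> bool" where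
  "regularly_almost_periodic_on act Y \<longleftrightarrow>
     (\<forall>\<alpha>. (\<forall>\<^sub>F p in uniformity_on Y. p \<in> \<alpha>) \<longrightarrow>
        (\<exists>A. normal_subgroup A \<and> syndetic A \<and>
             (\<forall>y\<in>Y. (\<lambda>t. act t y) ` A \<subseteq> {z. (y, z) \<in> \<alpha>})))"

end

theory Submission
  imports Defs
begin

text \<open>
  Let \<open>Y\<close> be an orbit closure and \<open>\<alpha>\<close> a clopen equivalence relation on \<open>Y\<close>, and let \<open>R\<^sub>m\<close> consist of
  the pairs that words of length at most \<open>m\<close> in the generators keep inside \<open>\<alpha>\<close>.  If the \<open>R\<^sub>m\<close> never
  stabilise, then for each \<open>m\<close> some pair of \<open>R\<^sub>m\<close> is moved out of \<open>R\<^sub>1\<close> by a word of length \<open>m\<close>, and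
  by compactness there is one pair \<open>q\<close> outside \<open>R\<^sub>1\<close> whose orbit meets every \<open>R\<^sub>m\<close>.  The orbit
  closure of \<open>q\<close> then meets the closed invariant set \<open>R = \<Inter>\<^sub>m R\<^sub>m\<close>.  In a distal flow orbit closures of
  pairs are minimal, because the Ellis semigroup is a group, so \<open>q\<close> lies in \<open>R\<close>, a contradiction.
  Hence \<open>R\<close> is some \<open>R\<^sub>m\<close>, so it is a clopen invariant equivalence relation with finitely many classes, and
  the kernel of the action of the group on these classes is the required normal subgroup.
\<close>

section \<open>Compactness and the topology of pointwise convergence\<close>

lemma compact_fun_imp_closed:
  fixes S :: "('a \<Rightarrow> 'b::t2_space) set"
  assumes "compact S"
  shows "closed S"
proof -
  have "Hausdorff_space (euclidean :: 'b topology)"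
    unfolding Hausdorff_space_def disjnt_def using hausdorff by auto
  then have "Hausdorff_space (euclidean :: ('a \<Rightarrow> 'b) topology)"
    using Hausdorff_space_product_topology[of "\<lambda>_. euclidean :: 'b topology" UNIV]
    by (simp add: euclidean_product_topology)
  then show ?thesis
    using assms compactin_imp_closedin by (metis closed_closedin compactin_euclidean_iff)
qed

text \<open>The coordinate of \<open>f \<circ> u\<close> at \<open>x\<close> is that of
  \<open>f\<close> at \<open>u x\<close>, so \<open>u\<close> may be discontinuous, as limits of
  translations can be.\<close>

lemma continuous_on_comp_right:
  fixes u :: "'a \<Rightarrow> 'b"
  shows "continuous_on UNIV (\<lambda>f :: 'b \<Rightarrow> 'c::topological_space. f \<circ> u)"
  by (intro continuous_on_coordinatewise_then_product) simp

lemma closed_eval: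
  fixes B :: "'b::topological_space set"
  assumes "closed B"
  shows "closed {f :: 'a \<Rightarrow> 'b. f x \<in> B}"
proof -
  have "continuous_on UNIV (\<lambda>f :: 'a \<Rightarrow> 'b. f x)"
    by simp
  from closed_vimage[OF assms this] show ?thesis
    by (simp add: vimage_def)
qed

lemma closed_eval_pair:
  fixes B :: "('b::topological_space \<times> 'b) set"
  assumes "closed B"
  shows "closed {f :: 'a \<Rightarrow> 'b. (f x, f y) \<in> B}"
proof -
  have "continuous_on UNIV (\<lambda>f :: 'a \<Rightarrow> 'b. (f x, f y))"
    by (intro continuous_on_Pair) simp_all
  from closed_vimage[OF assms this] show ?thesis
    by (simp add: vimage_def)
qed

lemma compact_Int_INT_decseq:
  fixes F :: "nat \<Rightarrow> 'a::topological_space set"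
  assumes "compact S" "\<And>n. closed (F n)" "\<And>n. S \<inter> F n \<noteq> {}" "decseq F"
  shows "S \<inter> (\<Inter>n. F n) \<noteq> {}"
proof (rule compact_imp_fip_image[OF assms(1)])
  fix I :: "nat set"
  assume "finite I"
  \<comment> \<open>\<open>insert 0\<close> gives \<open>Max\<close> a value when \<open>I\<close>
    is empty.\<close>
  then have "F (Max (insert 0 I)) \<subseteq> (\<Inter>i\<in>I. F i)"
    using assms(4) by (auto simp: decseq_def) (meson Max_ge finite_insert insertI2 subsetD)
  then show "S \<inter> (\<Inter>i\<in>I. F i) \<noteq> {}"
    using assms(3) by blast
qed (use assms in auto)

section \<open>Idempotents in compact semigroups of maps\<close>

lemma minimal_closed_subsemigroup:
  fixes T :: "('a \<Rightarrow> 'a::t2_space) set"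
  assumes "compact T" "T \<noteq> {}" "\<And>f g. f \<in> T \<Longrightarrow> g \<in> T \<Longrightarrow> f \<circ> g \<in> T"
  obtains S where "S \<subseteq> T" "S \<noteq> {}" "closed S" "\<And>f g. f \<in> S \<Longrightarrow> g \<in> S \<Longrightarrow> f \<circ> g \<in> S"
    and "\<And>S'. \<lbrakk>S' \<subseteq> S; S' \<noteq> {}; closed S'; \<And>f g. f \<in> S' \<Longrightarrow> g \<in> S' \<Longrightarrow> f \<circ> g \<in> S'\<rbrakk> \<Longrightarrow> S' = S"
proof -
  define P where "P S \<longleftrightarrow> S \<subseteq> T \<and> S \<noteq> {} \<and> closed S \<and> (\<forall>f\<in>S. \<forall>g\<in>S. f \<circ> g \<in> S)" for S
  \<comment> \<open>Zorn's lemma is applied to complements, so that a maximal element yields a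
    minimal subsemigroup and unions of chains become intersections.\<close>
  have "\<exists>M\<in>{V. P (- V)}. \<forall>X\<in>{V. P (- V)}. M \<subseteq> X \<longrightarrow> X = M"
  proof (rule subset_Zorn_nonempty)
    have "P T"
      using assms compact_fun_imp_closed by (auto simp: P_def)
    then have "- T \<in> {V. P (- V)}"
      by simp
    then show "{V. P (- V)} \<noteq> {}"
      by blast
    fix \<C>
    assume ne: "\<C> \<noteq> {}" and ch: "subset.chain {V. P (- V)} \<C>"
    have PC: "P (- V)" if "V \<in> \<C>" for V
      using ch that by (auto simp: subset_chain_def)
    have "T \<inter> (\<Inter>V\<in>\<C>. - V) \<noteq> {}"
    proof (rule compact_imp_fip_image[OF assms(1)])
      show "closed (- V)" if "V \<in> \<C>" for V
        using PC[OF that] by (simp add: P_def)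
      fix I
      assume I: "finite I" "I \<subseteq> \<C>"
      show "T \<inter> (\<Inter>V\<in>I. - V) \<noteq> {}"
      proof (cases "I = {}")
        case False
        \<comment> \<open>A finite nonempty chain contains its own union, so the intersection is
          itself one of the nonempty subsemigroups.\<close>
        then have "\<Union>I \<in> I"
          using I ch by (intro Union_in_chain subset.chain_extend subset.chainI)
            (unfold subset_chain_def, blast+)
        then have "P (- \<Union>I)"
          using PC I by blast
        then have "- \<Union>I \<noteq> {}" "- \<Union>I \<subseteq> T"
          unfolding P_def by iprover+
        moreover have "- \<Union>I = (\<Inter>V\<in>I. - V)"
          by blast
        ultimately show ?thesis
          by (metis Int_absorb1)
      qed (use assms(2) in simp)
    qed
    moreover have eq: "- \<Union>\<C> = (\<Inter>V\<in>\<C>. - V)"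
      by blast
    moreover have "closed (- \<Union>\<C>)"
      unfolding eq using PC unfolding P_def by (intro closed_INT) blast
    moreover have "- \<Union>\<C> \<subseteq> T"
    proof -
      obtain V where "V \<in> \<C>" "- V \<subseteq> T"
        using PC ne unfolding P_def by blast
      then show ?thesis
        by blast
    qed
    moreover have "f \<circ> g \<in> - \<Union>\<C>" if "f \<in> - \<Union>\<C>" "g \<in> - \<Union>\<C>" for f g
    proof -
      have "f \<circ> g \<in> - V" if V: "V \<in> \<C>" for V
      proof -
        have "\<forall>f\<in>- V. \<forall>g\<in>- V. f \<circ> g \<in> - V"
          using PC[OF V] unfolding P_def by iprover
        moreover have "f \<in> - V" "g \<in> - V"
          using V \<open>f \<in> - \<Union>\<C>\<close> \<open>g \<in> - \<Union>\<C>\<close> by auto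
        ultimately show ?thesis
          by blast
      qed
      then show ?thesis
        by blast
    qed
    moreover have "- \<Union>\<C> \<noteq> {}"
      using \<open>T \<inter> (\<Inter>V\<in>\<C>. - V) \<noteq> {}\<close> unfolding eq by blast
    ultimately have "P (- \<Union>\<C>)"
      unfolding P_def by (intro conjI ballI)
    then show "\<Union>\<C> \<in> {V. P (- V)}"
      by simp
  qed
  then obtain M where M: "P (- M)" "\<And>X. P (- X) \<Longrightarrow> M \<subseteq> X \<Longrightarrow> X = M"
    by blast
  show thesis
  proof
    show "S' = - M" if "S' \<subseteq> - M" "S' \<noteq> {}" "closed S'"
      "\<And>f g. f \<in> S' \<Longrightarrow> g \<in> S' \<Longrightarrow> f \<circ> g \<in> S'" for S'
    proof -
      have "P (- (- S'))"
        using that M(1) by (auto simp: P_def)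
      from M(2)[OF this] that(1) show ?thesis
        by blast
    qed
  qed (use M(1) in \<open>auto simp: P_def\<close>)
qed

text \<open>Minimality of \<open>S\<close> is applied twice: to the set of all
  \<open>f \<circ> u\<close>, which gives some \<open>v\<close> in \<open>S\<close> with
  \<open>v \<circ> u = u\<close>, and then to the set of all such \<open>v\<close>, which must
  therefore contain \<open>u\<close>.\<close>

lemma Ellis_Numakura:
  fixes T :: "('a \<Rightarrow> 'a::t2_space) set"
  assumes "compact T" "T \<noteq> {}" "\<And>f g. f \<in> T \<Longrightarrow> g \<in> T \<Longrightarrow> f \<circ> g \<in> T"
  obtains u where "u \<in> T" "u \<circ> u = u"
proof -
  obtain S where S: "S \<subseteq> T" "S \<noteq> {}" "closed S" "\<And>f g. f \<in> S \<Longrightarrow> g \<in> S \<Longrightarrow> f \<circ> g \<in> S"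
    and min: "\<And>S'. \<lbrakk>S' \<subseteq> S; S' \<noteq> {}; closed S'; \<And>f g. f \<in> S' \<Longrightarrow> g \<in> S' \<Longrightarrow> f \<circ> g \<in> S'\<rbrakk> \<Longrightarrow> S' = S"
    using minimal_closed_subsemigroup[OF assms] by metis
  obtain u where u: "u \<in> S"
    using S(2) by blast
  have "compact S"
    using closed_Int_compact[OF S(3) assms(1)] S(1) by (simp add: Int_absorb2)
  then have "compact ((\<lambda>f. f \<circ> u) ` S)"
    by (intro compact_continuous_image continuous_on_subset[OF continuous_on_comp_right]) auto
  then have "(\<lambda>f. f \<circ> u) ` S = S"
  proof (intro min compact_fun_imp_closed)
    fix f g
    assume "f \<in> (\<lambda>f. f \<circ> u) ` S" "g \<in> (\<lambda>f. f \<circ> u) ` S"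
    then obtain f' g' where fg: "f' \<in> S" "g' \<in> S" "f = f' \<circ> u" "g = g' \<circ> u"
      by auto
    have "f \<circ> g = (f' \<circ> u \<circ> g') \<circ> u"
      by (simp add: fg comp_assoc)
    then show "f \<circ> g \<in> (\<lambda>f. f \<circ> u) ` S"
      using fg u S(4) by blast
  qed (use u S(4) in auto)
  with u have "u \<in> (\<lambda>f. f \<circ> u) ` S"
    by simp
  then obtain v where "v \<in> S" "v \<circ> u = u"
    by (metis imageE)
  then have ne: "S \<inter> {f. f \<circ> u = u} \<noteq> {}"
    by auto
  \<comment> \<open>As a family of pointwise conditions on \<open>f\<close>, the equation defines a
    closed set because points are closed.\<close>
  have "{f. f \<circ> u = u} = (\<Inter>x. {f. f (u x) \<in> {u x}})"
    by (auto simp: fun_eq_iff)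
  then have "closed {f. f \<circ> u = u}"
    by (simp only:) (intro closed_INT ballI closed_eval, simp)
  then have "S \<inter> {f. f \<circ> u = u} = S"
    using ne S(3,4) by (intro min) (auto simp: comp_assoc)
  then show thesis
    using that u S(1) by blast
qed

section \<open>Clopen equivalence relations on a compact zero-dimensional set\<close>

text \<open>By compactness finitely many relatively clopen sets with squares inside \<beta> cover
  \<open>Y\<close>; points are related when they lie in the same ones of these sets. Clopenness in
  \<open>Y \<times> Y\<close> is expressed by two closed sets of the ambient space.\<close>

lemma zero_dimensional_clopen_equiv:
  fixes Y :: "'a::{uniform_space, t2_space} set"
  assumes Y: "compact Y" "zero_dimensional_space (top_of_set Y)"
    and \<beta>: "\<forall>\<^sub>F p in uniformity_on Y. p \<in> \<beta>"
  obtains \<alpha> where "equiv Y \<alpha>" "\<alpha> \<subseteq> \<beta>" "closed \<alpha>" "closed (Y \<times> Y - \<alpha>)"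
proof -
  have clY: "closed Y"
    by (simp add: Y(1) compact_imp_closed)
  have "\<exists>W. open W \<and> y \<in> W \<and> closed (Y \<inter> W) \<and> closed (Y - W) \<and> (Y \<inter> W) \<times> (Y \<inter> W) \<subseteq> \<beta>"
    if y: "y \<in> Y" for y
  proof -
    have "\<forall>\<^sub>F p in uniformity. p \<in> Y \<times> Y \<longrightarrow> p \<in> \<beta>"
      using \<beta> by (simp add: eventually_inf_principal)
    then obtain D where D: "eventually D uniformity"
      "\<And>a b c. D (a, b) \<Longrightarrow> D (b, c) \<Longrightarrow> (a, c) \<in> Y \<times> Y \<longrightarrow> (a, c) \<in> \<beta>"
      by (rule uniformity_transE) metis
    \<comment> \<open>Both orders matter: points \<open>a\<close> and \<open>b\<close> near
      \<open>y\<close> are compared through \<open>y\<close>, by \<open>D (a, y)\<close> and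
      \<open>D (y, b)\<close>.\<close>
    have "\<forall>\<^sub>F z in nhds y. D (y, z) \<and> D (z, y)"
      unfolding eventually_nhds_uniformity using D(1) uniformity_sym[OF D(1)]
      by eventually_elim auto
    then obtain V where V: "open V" "y \<in> V" "\<And>z. z \<in> V \<Longrightarrow> D (y, z) \<and> D (z, y)"
      by (auto simp: eventually_nhds)
    obtain \<B> where \<B>: "\<forall>B\<in>\<B>. openin (top_of_set Y) B \<and> closedin (top_of_set Y) B"
      "\<forall>U. openin (top_of_set Y) U \<longrightarrow> (\<exists>\<C>\<subseteq>\<B>. U = \<Union>\<C>)"
      using Y(2) unfolding zero_dimensional_space_def by iprover
    have "openin (top_of_set Y) (Y \<inter> V)"
      using V(1) by blast
    with \<B>(2) obtain \<C> where "\<C> \<subseteq> \<B>" "Y \<inter> V = \<Union>\<C>"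
      by (metis (no_types, lifting))
    then obtain B where B: "B \<in> \<B>" "y \<in> B" "B \<subseteq> Y \<inter> V"
      using y V(2) by blast
    have clopen: "openin (top_of_set Y) B" "closedin (top_of_set Y) B"
      using \<B>(1) B(1) by auto
    then obtain W where W: "open W" "B = Y \<inter> W"
      by (auto simp: openin_open)
    have "closed B"
      using closedin_closed_trans[OF clopen(2) clY] .
    moreover have "closed (Y - W)"
      using W(1) clY by blast
    moreover have "B \<times> B \<subseteq> \<beta>"
    proof clarify
      fix a b
      assume "a \<in> B" "b \<in> B"
      then show "(a, b) \<in> \<beta>"
        using D(2) V(3) B(3) by (meson IntD1 IntD2 SigmaI subsetD)
    qed
    ultimately show ?thesis
      using W B(2) by blast
  qed
  then have "\<exists>W. \<forall>y\<in>Y. open (W y) \<and> y \<in> W y \<and> closed (Y \<inter> W y) \<and> closed (Y - W y) \<and>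
      (Y \<inter> W y) \<times> (Y \<inter> W y) \<subseteq> \<beta>"
    by (intro bchoice ballI)
  then obtain W where W: "\<And>y. y \<in> Y \<Longrightarrow> open (W y)" "\<And>y. y \<in> Y \<Longrightarrow> y \<in> W y"
    "\<And>y. y \<in> Y \<Longrightarrow> closed (Y \<inter> W y)" "\<And>y. y \<in> Y \<Longrightarrow> closed (Y - W y)"
    "\<And>y. y \<in> Y \<Longrightarrow> (Y \<inter> W y) \<times> (Y \<inter> W y) \<subseteq> \<beta>"
    by auto
  have "Y \<subseteq> (\<Union>y\<in>Y. W y)"
    using W(2) by auto
  from compactE_image[OF Y(1) W(1) this]
  obtain P where P: "P \<subseteq> Y" "finite P" "Y \<subseteq> (\<Union>p\<in>P. W p)"
    by auto
  define \<alpha> where "\<alpha> = {(a, b) \<in> Y \<times> Y. \<forall>p\<in>P. a \<in> W p \<longleftrightarrow> b \<in> W p}"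
  have "\<alpha> = Y \<times> Y \<inter> (\<Inter>p\<in>P. (Y \<inter> W p) \<times> (Y \<inter> W p) \<union> (Y - W p) \<times> (Y - W p))"
    by (auto simp: \<alpha>_def)
  moreover have "closed \<dots>"
    using P(1) by (intro closed_Int[OF closed_Times[OF clY clY]] closed_INT ballI closed_Un
        closed_Times W(3,4)) auto
  ultimately have 1: "closed \<alpha>"
    by simp
  have "Y \<times> Y - \<alpha> = (\<Union>p\<in>P. (Y \<inter> W p) \<times> (Y - W p) \<union> (Y - W p) \<times> (Y \<inter> W p))"
    by (auto simp: \<alpha>_def)
  moreover have "closed \<dots>"
    using P(1,2) by (intro closed_UN ballI closed_Un closed_Times W(3,4)) auto
  ultimately have 2: "closed (Y \<times> Y - \<alpha>)"
    by simp
  have 3: "equiv Y \<alpha>"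
    unfolding \<alpha>_def by (intro equivI refl_onI symI transI) auto
  have "\<alpha> \<subseteq> \<beta>"
  proof clarify
    fix a b
    assume ab: "(a, b) \<in> \<alpha>"
    then obtain p where "p \<in> P" "a \<in> W p"
      using P(3) by (auto simp: \<alpha>_def)
    then show "(a, b) \<in> \<beta>"
      using ab P(1) W(5)[of p] by (auto simp: \<alpha>_def)
  qed
  with 1 2 3 show thesis
    using that by blast
qed

section \<open>Powers of the generating set\<close>

lemma funpow_set_plus_add:
  fixes \<Gamma> :: "'g::monoid_add set"
  shows "((+) \<Gamma> ^^ (m + n)) {0} = ((+) \<Gamma> ^^ m) {0} + ((+) \<Gamma> ^^ n) {0}"
  by (induction m) (simp_all add: add.assoc flip: set_zero)

text \<open>\<open>funpow\<close> adds letters on the left; splitting them off on the right serves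
  to invert words and to pass from a pair to its image under a generator.\<close>

lemma funpow_set_plus_Suc_right:
  fixes \<Gamma> :: "'g::monoid_add set"
  shows "((+) \<Gamma> ^^ Suc n) {0} = ((+) \<Gamma> ^^ n) {0} + \<Gamma>"
  using funpow_set_plus_add[of n 1 \<Gamma>] by (simp flip: set_zero)

lemma compact_set_plus:
  fixes A B :: "'g::topological_monoid_add set"
  assumes "compact A" "compact B"
  shows "compact (A + B)"
proof -
  have "A + B = (\<lambda>(a, b). a + b) ` (A \<times> B)"
    by (auto simp: set_plus_def)
  moreover have "compact \<dots>"
    using assms by (intro compact_continuous_image compact_Times)
      (auto simp: case_prod_unfold intro!: continuous_intros)
  ultimately show ?thesis
    by simp
qed

lemma compact_funpow_set_plus:
  fixes \<Gamma> :: "'g::topological_monoid_add set"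
  assumes "compact \<Gamma>"
  shows "compact (((+) \<Gamma> ^^ n) {0})"
  using assms by (induction n) (auto intro: compact_set_plus)

text \<open>Inversion reverses a word, so a letter split off on the left returns on the
  right.\<close>

lemma uminus_funpow_set_plus:
  fixes \<Gamma> :: "'g::group_add set"
  assumes "\<Gamma> = uminus ` \<Gamma>" "g \<in> ((+) \<Gamma> ^^ n) {0}"
  shows "- g \<in> ((+) \<Gamma> ^^ n) {0}"
  using assms(2)
proof (induction n arbitrary: g)
  case (Suc n)
  then obtain a h where g: "a \<in> \<Gamma>" "h \<in> ((+) \<Gamma> ^^ n) {0}" "g = a + h"
    by (auto elim: set_plus_elim)
  then have "- a \<in> \<Gamma>"
    using assms(1) by blast
  then show ?case
    unfolding funpow_set_plus_Suc_right g(3) minus_add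
    using Suc.IH g(2) by (intro set_plus_intro)
qed simp

lemma zero_in_funpow_set_plus:
  fixes \<Gamma> :: "'g::monoid_add set"
  assumes "0 \<in> \<Gamma>"
  shows "0 \<in> ((+) \<Gamma> ^^ n) {0}"
proof (induction n)
  case (Suc n)
  then show ?case
    using set_plus_intro[OF assms Suc] by simp
qed simp

section \<open>The diagonal action and the Ellis semigroup\<close>

context flow
begin

definition act2 :: "'g \<Rightarrow> 'x \<times> 'x \<Rightarrow> 'x \<times> 'x" where
  "act2 t q = (act t (fst q), act t (snd q))"

lemma act2_zero [simp]: "act2 0 q = q"
  by (simp add: act2_def act_zero)

lemma act2_add: "act2 (s + t) q = act2 s (act2 t q)"
  by (simp add: act2_def act_add)

lemma act_uminus [simp]: "act (- t) (act t x) = x" "act t (act (- t) x) = x"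
  by (simp_all add: act_zero flip: act_add)

lemma continuous_on_act_comp:
  assumes "continuous_on S f" "continuous_on S h"
  shows "continuous_on S (\<lambda>z. act (f z) (h z))"
  using continuous_on_compose2[OF continuous_act continuous_on_Pair[OF assms]] by simp

lemma continuous_on_act2: "continuous_on S (\<lambda>(v, q). act2 v q)"
  unfolding act2_def case_prod_unfold
  by (intro continuous_on_Pair continuous_on_act_comp continuous_intros)

lemma closed_vimage_act2:
  assumes "closed B"
  shows "closed {q. act2 v q \<in> B}"
proof -
  have "continuous_on UNIV (act2 v)"
    unfolding act2_def by (intro continuous_on_Pair continuous_on_act_comp continuous_intros)
  from closed_vimage[OF assms this] show ?thesis
    by (simp add: vimage_def)
qed

text \<open>Joint continuity makes this the projection of a closed subset of the compact
  \<open>F \<times> Z\<close>. Existential conditions over words of bounded length thus define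
  closed sets.\<close>

lemma compact_act2_hits:
  assumes "compact F" "compact Z" "closed B"
  shows "compact {q\<in>Z. \<exists>v\<in>F. act2 v q \<in> B}"
proof -
  have "{q\<in>Z. \<exists>v\<in>F. act2 v q \<in> B} = snd ` ((F \<times> Z) \<inter> (\<lambda>(v, q). act2 v q) -` B)"
    by force
  moreover have "compact \<dots>"
    using assms continuous_on_act2
    by (intro compact_continuous_image compact_Int_closed compact_Times closed_vimage
        continuous_intros)
  ultimately show ?thesis
    by simp
qed

lemma act_orbit_closure:
  assumes "y \<in> orbit_closure act x"
  shows "act t y \<in> orbit_closure act x"
proof -
  have "act t ` closure (range (\<lambda>s. act s x)) \<subseteq> closure (range (\<lambda>s. act s x))"
  proof (rule image_closure_subset)
    show "continuous_on (closure (range (\<lambda>s. act s x))) (act t)"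
      by (intro continuous_on_act_comp continuous_intros)
    have "act t (act s x) \<in> range (\<lambda>s. act s x)" for s
      by (metis act_add rangeI)
    then show "act t ` range (\<lambda>s. act s x) \<subseteq> closure (range (\<lambda>s. act s x))"
      using closure_subset by fastforce
  qed simp
  then show ?thesis
    using assms by blast
qed

lemma orbit_closure_self: "x \<in> orbit_closure act x"
  by (metis act_zero closure_subset rangeI subsetD)

text \<open>The enveloping semigroup: the closure is taken for pointwise convergence.\<close>

definition ellis :: "('x \<Rightarrow> 'x) set" where
  "ellis = closure (range act)"

lemma ellis_memI:
  assumes "p \<in> ellis" "closed B" "\<And>g. act g \<in> B"
  shows "p \<in> B"
  using assms closure_minimal[of "range act" B] by (auto simp: ellis_def)

lemma act_in_ellis: "act g \<in> ellis"
  by (simp add: ellis_def closure_subset[THEN subsetD])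

text \<open>By Tychonoff's theorem the product of all orbit closures is compact, and it contains
  every translation.\<close>

lemma compact_ellis: "compact ellis"
proof -
  let ?C = "PiE UNIV (\<lambda>x. orbit_closure act x)"
  have "compactin (product_topology (\<lambda>_. euclidean) UNIV) ?C"
    using compact_orbit_closure by (simp add: compactin_PiE)
  then have C: "compact ?C"
    by (simp add: euclidean_product_topology)
  have "ellis \<subseteq> ?C"
    unfolding ellis_def
    using C by (intro closure_minimal compact_fun_imp_closed)
      (auto intro: closure_subset[THEN subsetD])
  then show ?thesis
    using closed_Int_compact[OF _ C, of ellis] by (simp add: Int_absorb2 ellis_def)
qed

text \<open>Two passages to the limit: first in the right factor, with a continuous translation on
  the left, then in the left factor, with the right one fixed.\<close>

lemma comp_in_ellis:
  assumes "p \<in> ellis" "q \<in> ellis"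
  shows "p \<circ> q \<in> ellis"
proof -
  have clo: "closed {f. f \<circ> u \<in> ellis}" for u
    using closed_vimage[OF _ continuous_on_comp_right, of ellis u]
    by (simp add: ellis_def vimage_def)
  have "act g \<circ> q \<in> ellis" for g
  proof -
    have "continuous_on UNIV (\<lambda>f. act g \<circ> f)"
    proof (rule continuous_on_coordinatewise_then_product)
      show "continuous_on UNIV (\<lambda>f. (act g \<circ> f) x)" for x
        unfolding comp_def by (intro continuous_on_act_comp) simp_all
    qed
    from closed_vimage[OF _ this, of ellis] have "closed {f. act g \<circ> f \<in> ellis}"
      by (simp add: ellis_def vimage_def)
    moreover have "act g \<circ> act h \<in> ellis" for h
      using act_in_ellis[of "g + h"] by (simp add: comp_def act_add[abs_def])
    ultimately show ?thesis
      using ellis_memI[OF assms(2), of "{f. act g \<circ> f \<in> ellis}"] by simp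
  qed
  then show ?thesis
    using ellis_memI[OF assms(1) clo, of q] by simp
qed

text \<open>An idempotent \<open>u\<close> sends both \<open>x\<close> and \<open>u x\<close> to
  \<open>u x\<close>, so the orbit closure of the pair \<open>(x, u x)\<close> meets the
  diagonal.\<close>

lemma distal_idempotent:
  assumes "distal act" "u \<in> ellis" "u \<circ> u = u"
  shows "u = id"
proof
  fix x
  let ?C = "closure (range (\<lambda>g. (act g x, act g (u x))))"
  have "u \<in> {f. (f x, f (u x)) \<in> ?C}"
    by (rule ellis_memI[OF assms(2) closed_eval_pair]) (auto intro: closure_subset[THEN subsetD])
  moreover have "u (u x) = u x"
    using assms(3) by (metis comp_apply)
  ultimately have "?C \<inter> Id \<noteq> {}"
    by auto
  then show "u x = id x"
    using assms(1) unfolding distal_def by (metis id_apply)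
qed

text \<open>The maps \<open>f \<circ> p\<close> with \<open>f\<close> in \<open>ellis\<close> form a
  compact semigroup; its idempotent can only be the identity.\<close>

lemma distal_left_inverse:
  assumes "distal act" "p \<in> ellis"
  obtains q where "q \<in> ellis" "q \<circ> p = id"
proof -
  let ?T = "(\<lambda>f. f \<circ> p) ` ellis"
  have "compact ?T"
    by (intro compact_continuous_image compact_ellis
        continuous_on_subset[OF continuous_on_comp_right]) auto
  moreover have "?T \<noteq> {}"
    using assms(2) by blast
  moreover have "f \<circ> g \<in> ?T" if fg: "f \<in> ?T" "g \<in> ?T" for f g
  proof -
    obtain f' g' where f'g': "f' \<in> ellis" "g' \<in> ellis" "f = f' \<circ> p" "g = g' \<circ> p"
      using fg by blast
    then have "f \<circ> g = (f' \<circ> p \<circ> g') \<circ> p"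
      by (simp add: comp_assoc)
    then show ?thesis
      using f'g' assms(2) comp_in_ellis by blast
  qed
  ultimately obtain u where u: "u \<in> ?T" "u \<circ> u = u"
    using Ellis_Numakura by metis
  then have "u = id"
    using distal_idempotent[OF assms(1)] comp_in_ellis assms(2) by blast
  then show thesis
    using u(1) that by fastforce
qed

text \<open>Some \<open>p\<close> in \<open>ellis\<close> carries \<open>q\<close> to
  \<open>z\<close>, and a left inverse of \<open>p\<close> carries \<open>z\<close> back. Being
  closed and invariant, \<open>R\<close> is preserved by all of \<open>ellis\<close>.\<close>

lemma orbit_closure_act2_minimal:
  assumes "distal act" "closed R" "\<And>q g. q \<in> R \<Longrightarrow> act2 g q \<in> R"
    and z: "z \<in> closure (range (\<lambda>t. act2 t q))" "z \<in> R"
  shows "q \<in> R"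
proof -
  let ?ev = "\<lambda>w f. (f (fst w), f (snd w))"
  have "continuous_on ellis (?ev q)"
    by (intro continuous_on_Pair continuous_on_subset[OF continuous_on_product_coordinates]) auto
  \<comment> \<open>A closed set containing the orbit contains its closure, so every point of that
    closure is a value of some \<open>p\<close>.\<close>
  then have "closed (?ev q ` ellis)"
    by (intro compact_imp_closed compact_continuous_image compact_ellis)
  moreover have "range (\<lambda>t. act2 t q) \<subseteq> ?ev q ` ellis"
    using act_in_ellis by (auto simp: act2_def)
  ultimately have "z \<in> ?ev q ` ellis"
    using closure_minimal z(1) by blast
  then obtain p where p: "p \<in> ellis" "z = ?ev q p"
    by blast
  obtain p' where p': "p' \<in> ellis" "p' \<circ> p = id"
    using distal_left_inverse[OF assms(1) p(1)] by blast
  have "p' \<in> {f. ?ev z f \<in> R}"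
    using assms(3)[OF z(2)] by (intro ellis_memI[OF p'(1) closed_eval_pair[OF assms(2)]])
      (auto simp: act2_def)
  moreover have "?ev z p' = q"
    using p'(2) by (simp add: p(2) fun_eq_iff)
  ultimately show ?thesis
    by simp
qed

section \<open>Stabilisation of the relations kept by words of bounded length\<close>

text \<open>The set removed is the largest invariant subset of \<alpha>. As an intersection over the
  whole group it is closed; that it is also open in \<open>Y \<times> Y\<close> comes from its being
  a single \<open>R r\<close>.\<close>

lemma open_invariant_core:
  fixes \<Gamma> :: "'g set"
  assumes "distal act"
    and \<Gamma>: "compact \<Gamma>" "0 \<in> \<Gamma>" "\<Gamma> = uminus ` \<Gamma>" "UNIV = (\<Union>r\<in>{1..}. ((+) \<Gamma> ^^ r) {0})"
    and Y: "compact Y" "\<And>t y. y \<in> Y \<Longrightarrow> act t y \<in> Y"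
    and \<alpha>: "\<alpha> \<subseteq> Y \<times> Y" "closed \<alpha>" "closed (Y \<times> Y - \<alpha>)"
  shows "closed (Y \<times> Y - {q. \<forall>g. act2 g q \<in> \<alpha>})"
proof -
  define F where "F r = ((+) \<Gamma> ^^ r) {0}" for r
  define R where "R r = {q \<in> Y \<times> Y. \<forall>v\<in>F r. act2 v q \<in> \<alpha>}" for r
  define Rinf where "Rinf = {q. \<forall>g. act2 g q \<in> \<alpha>}"
  have F_Suc: "g \<in> F (Suc n) \<longleftrightarrow> (\<exists>a\<in>\<Gamma>. \<exists>h\<in>F n. g = a + h)" for g n
    by (auto simp: F_def set_plus_def)
  have F_Suc': "g \<in> F (Suc n) \<longleftrightarrow> (\<exists>a\<in>\<Gamma>. \<exists>h\<in>F n. g = h + a)" for g n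
    unfolding F_def funpow_set_plus_Suc_right by (auto simp: set_plus_def)
  have F0: "0 \<in> F n" for n
    unfolding F_def by (rule zero_in_funpow_set_plus[OF \<Gamma>(2)])
  have F_uminus: "- g \<in> F n" if "g \<in> F n" for g n
    using that unfolding F_def by (rule uminus_funpow_set_plus[OF \<Gamma>(3)])
  have F_compact: "compact (F n)" for n
    unfolding F_def by (rule compact_funpow_set_plus[OF \<Gamma>(1)])
  have F_UNIV: "\<exists>r. g \<in> F r" for g
    using \<Gamma>(4) by (auto simp: F_def)
  have F1: "F 1 = \<Gamma>"
    by (simp add: F_def flip: set_zero)
  have act2_Y: "act2 g q \<in> Y \<times> Y" if "q \<in> Y \<times> Y" for g q
    using that Y(2) by (auto simp: act2_def)
  have YY: "compact (Y \<times> Y)"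
    by (intro compact_Times Y(1))
  have R_eq: "R r = Y \<times> Y \<inter> (\<Inter>v\<in>F r. {q. act2 v q \<in> \<alpha>})" for r
    by (auto simp: R_def)
  have R_closed: "closed (R r)" for r
    unfolding R_eq using compact_imp_closed[OF YY] closed_vimage_act2[OF \<alpha>(2)] by auto
  have R_compl: "closed (Y \<times> Y - R r)" for r
  proof -
    have "Y \<times> Y - R r = {q \<in> Y \<times> Y. \<exists>v\<in>F r. act2 v q \<in> Y \<times> Y - \<alpha>}"
      using act2_Y by (auto simp: R_def)
    then show ?thesis
      using compact_imp_closed[OF compact_act2_hits[OF F_compact[of r] YY \<alpha>(3)]] by (simp only:)
  qed
  have "F n \<subseteq> F (Suc n)" for n
    using F_Suc \<Gamma>(2) by force
  then have R_Suc: "R (Suc n) \<subseteq> R n" for n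
    by (auto simp: R_def)
  \<comment> \<open>Applying a generator costs one level: a word of length \<open>n\<close> after
    \<open>a\<close> is a word of length \<open>n + 1\<close>.\<close>
  have R_step: "act2 a q \<in> R n" if "a \<in> \<Gamma>" "q \<in> R (Suc n)" for a q n
  proof -
    have "act2 v (act2 a q) \<in> \<alpha>" if "v \<in> F n" for v
    proof -
      have "v + a \<in> F (Suc n)"
        using F_Suc' \<open>a \<in> \<Gamma>\<close> that by blast
      then show ?thesis
        using \<open>q \<in> R (Suc n)\<close> by (simp add: R_def flip: act2_add)
    qed
    then show ?thesis
      using that(2) act2_Y unfolding R_def by blast
  qed
  have Rinf_sub: "Rinf \<subseteq> R n" for n
  proof
    fix q
    assume q: "q \<in> Rinf"
    then have "act2 0 q \<in> \<alpha>"
      unfolding Rinf_def by blast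
    then show "q \<in> R n"
      using q \<alpha>(1) by (auto simp: R_def Rinf_def)
  qed
  have Rinf_eq: "(\<Inter>n. R n) = Rinf"
    using Rinf_sub F_UNIV by (fastforce simp: R_def Rinf_def)
  have Rinf_inv: "act2 g q \<in> Rinf" if "q \<in> Rinf" for g q
    using that by (simp add: Rinf_def flip: act2_add)
  have "\<exists>r. R r \<subseteq> R (Suc r)"
  proof (rule ccontr)
    assume neg: "\<nexists>r. R r \<subseteq> R (Suc r)"
    \<comment> \<open>The candidates avoid \<open>R 1\<close>, a relatively open set that does not
      depend on \<open>m\<close>, so a common point of all \<open>C m\<close> still avoids
      it.\<close>
    define C where "C m = {q \<in> Y \<times> Y - R 1. \<exists>w\<in>F m. act2 w q \<in> R m}" for m
    have cYR: "compact (Y \<times> Y - R 1)"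
      using closed_Int_compact[OF R_compl YY, of 1] by (simp add: Int_absorb2)
    have C_closed: "closed (C m)" for m
      unfolding C_def by (intro compact_imp_closed compact_act2_hits F_compact cYR R_closed)
    have C_ne: "C m \<noteq> {}" for m
    proof -
      \<comment> \<open>The witness is \<open>p\<close> just before the last letter \<open>a\<close>
        of the escaping word: \<open>a\<close> then leaves \<alpha>, and \<open>- h\<close> leads
        back into \<open>R m\<close>.\<close>
      obtain p where p: "p \<in> R m" "p \<notin> R (Suc m)"
        using neg by blast
      then obtain g where g: "g \<in> F (Suc m)" "act2 g p \<notin> \<alpha>"
        by (auto simp: R_def)
      then obtain a h where ah: "a \<in> \<Gamma>" "h \<in> F m" "g = a + h"
        using F_Suc by blast
      have "act2 h p \<notin> R 1"
        using g(2) ah(1,3) F1 by (auto simp: R_def act2_add)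
      moreover have "act2 (- h) (act2 h p) = p"
        by (simp flip: act2_add)
      moreover have "act2 h p \<in> Y \<times> Y"
        using p(1) act2_Y by (auto simp: R_def)
      ultimately have "act2 h p \<in> C m"
        using p(1) F_uminus[OF ah(2)] unfolding C_def by force
      then show ?thesis
        by blast
    qed
    have "C (Suc m) \<subseteq> C m" for m
    proof
      fix q
      assume "q \<in> C (Suc m)"
      then obtain w where w: "q \<in> Y \<times> Y - R 1" "w \<in> F (Suc m)" "act2 w q \<in> R (Suc m)"
        by (auto simp: C_def)
      then obtain a w' where aw: "a \<in> \<Gamma>" "w' \<in> F m" "w = a + w'"
        using F_Suc by blast
      \<comment> \<open>Undoing the last letter of \<open>w\<close> shortens the word by one and
        lowers the level by one.\<close>
      have "- a \<in> \<Gamma>"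
        using \<Gamma>(3) aw(1) by blast
      from R_step[OF this w(3)] have "act2 w' q \<in> R m"
        by (simp add: aw(3) add.assoc[symmetric] flip: act2_add)
      then show "q \<in> C m"
        using w(1) aw(2) by (auto simp: C_def)
    qed
    then have "decseq C"
      by (simp add: decseq_Suc_iff)
    have "(Y \<times> Y) \<inter> C m \<noteq> {}" for m
      using C_ne[of m] by (auto simp: C_def)
    from compact_Int_INT_decseq[OF YY C_closed this \<open>decseq C\<close>]
    obtain q where q: "\<And>m. q \<in> C m"
      by auto
    let ?O = "closure (range (\<lambda>t. act2 t q))"
    have q_YY: "q \<in> Y \<times> Y" and q_R1: "q \<notin> R 1"
      using q[of 0] by (auto simp: C_def)
    have "?O \<subseteq> Y \<times> Y"
      using act2_Y[OF q_YY] by (intro closure_minimal compact_imp_closed[OF YY] image_subsetI)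
    then have "compact ?O"
      using closed_Int_compact[OF closed_closure YY, of "range (\<lambda>t. act2 t q)"]
      by (simp add: Int_absorb2)
    moreover have "?O \<inter> R m \<noteq> {}" for m
    proof -
      obtain w where "act2 w q \<in> R m"
        using q[of m] by (auto simp: C_def)
      then show ?thesis
        using closure_subset[of "range (\<lambda>t. act2 t q)"] by blast
    qed
    moreover have "decseq R"
      using R_Suc by (simp add: decseq_Suc_iff)
    ultimately obtain z where z: "z \<in> ?O" "z \<in> Rinf"
      using compact_Int_INT_decseq[of ?O R] R_closed Rinf_eq by auto
    have "closed Rinf"
      unfolding Rinf_eq[symmetric] using R_closed by blast
    from orbit_closure_act2_minimal[OF assms(1) this Rinf_inv z] have "q \<in> Rinf" .
    then show False
      using q_R1 Rinf_sub by blast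
  qed
  then obtain r where r: "R r \<subseteq> R (Suc r)"
    by blast
  \<comment> \<open>One equality of consecutive levels suffices: a generator maps
    \<open>R (Suc r)\<close> into \<open>R r\<close>, hence \<open>R r\<close> into itself.\<close>
  have R_inv: "act2 g q \<in> R r" if "g \<in> F n" "q \<in> R r" for g q n
    using that
  proof (induction n arbitrary: g q)
    case 0
    then show ?case
      by (simp add: F_def)
  next
    case (Suc n)
    then obtain a h where ah: "a \<in> \<Gamma>" "h \<in> F n" "g = a + h"
      using F_Suc by blast
    then have "act2 h q \<in> R (Suc r)"
      using Suc.IH Suc.prems(2) r by blast
    from R_step[OF ah(1) this] show ?case
      by (simp add: ah(3) act2_add)
  qed
  have "R r \<subseteq> Rinf"
  proof
    fix q
    assume q: "q \<in> R r"
    have "act2 g q \<in> \<alpha>" for g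
    proof -
      have "act2 g q \<in> R r"
        using F_UNIV R_inv q by blast
      then have "act2 0 (act2 g q) \<in> \<alpha>"
        using F0 unfolding R_def by blast
      then show ?thesis
        by simp
    qed
    then show "q \<in> Rinf"
      by (simp add: Rinf_def)
  qed
  then have "R r = Rinf"
    using Rinf_sub by blast
  then show ?thesis
    using R_compl[of r] by (simp add: Rinf_def)
qed

section \<open>The kernel of the action on finitely many classes\<close>

text \<open>\<open>A\<close> is the kernel of the action on the classes of \<open>R\<close>. Since
  \<open>P\<close> meets every class, only finitely many permutations of the classes occur, so
  \<open>A\<close> has finite index.\<close>

lemma kernel_of_finite_quotient:
  assumes Y: "\<And>t y. y \<in> Y \<Longrightarrow> act t y \<in> Y"
    and R: "equiv Y R" "\<And>q g. q \<in> R \<Longrightarrow> act2 g q \<in> R"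
    and P: "finite P" "P \<subseteq> Y" "\<And>y. y \<in> Y \<Longrightarrow> \<exists>p\<in>P. (p, y) \<in> R"
  defines "A \<equiv> {t. \<forall>y\<in>Y. (y, act t y) \<in> R}"
  shows "normal_subgroup A" "syndetic A"
proof -
  have R_act: "(act g a, act g b) \<in> R" if "(a, b) \<in> R" for g a b
    using R(2)[OF that] by (simp add: act2_def)
  have R_sym: "(b, a) \<in> R" if "(a, b) \<in> R" for a b
    using R(1) that by (auto simp: equiv_def dest: symD)
  have R_trans: "(a, c) \<in> R" if "(a, b) \<in> R" "(b, c) \<in> R" for a b c
    using R(1) that by (auto simp: equiv_def dest: transD)
  have R_refl: "(a, a) \<in> R" if "a \<in> Y" for a
    using R(1) that by (auto simp: equiv_def dest: refl_onD)
  show "normal_subgroup A"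
    unfolding normal_subgroup_def
  proof (intro conjI ballI allI)
    show "0 \<in> A"
      using R_refl by (simp add: A_def act_zero)
    show "a + b \<in> A" if "a \<in> A" "b \<in> A" for a b
    proof -
      have "(y, act (a + b) y) \<in> R" if "y \<in> Y" for y
        using that \<open>a \<in> A\<close> \<open>b \<in> A\<close> Y[of y b] R_trans[of y "act b y"] by (auto simp: A_def act_add)
      then show ?thesis
        by (simp add: A_def)
    qed
    show "- a \<in> A" if "a \<in> A" for a
    proof -
      have "(y, act (- a) y) \<in> R" if "y \<in> Y" for y
        using that \<open>a \<in> A\<close> Y[of y "- a"] R_sym by (force simp: A_def)
      then show ?thesis
        by (simp add: A_def)
    qed
    show "g + a - g \<in> A" if "a \<in> A" for g a
    proof -
      have "(y, act (g + a - g) y) \<in> R" if "y \<in> Y" for y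
      proof -
        have "(act (- g) y, act a (act (- g) y)) \<in> R"
          using that \<open>a \<in> A\<close> Y by (auto simp: A_def)
        from R_act[OF this, of g] show ?thesis
          by (simp add: act_add diff_conv_add_uminus del: add_uminus_conv_diff)
      qed
      then show ?thesis
        by (simp add: A_def)
    qed
  qed
  obtain c where c: "\<And>y. y \<in> Y \<Longrightarrow> c y \<in> P \<and> (c y, y) \<in> R"
    using P(3) by metis
  \<comment> \<open>\<phi> records the permutation of the classes through chosen representatives; it
    takes finitely many values and determines the action modulo \<open>R\<close>.\<close>
  define \<phi> where "\<phi> g = restrict (\<lambda>p. c (act g p)) P" for g
  have "range \<phi> \<subseteq> PiE P (\<lambda>_. P)"
    using c Y P(2) by (auto simp: \<phi>_def)
  then have fin: "finite (range \<phi>)"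
    using P(1) finite_PiE finite_subset by metis
  have same: "(act g y, act h y) \<in> R" if gh: "\<phi> g = \<phi> h" and y: "y \<in> Y" for g h y
  proof -
    obtain p where p: "p \<in> P" "(p, y) \<in> R"
      using P(3) y by blast
    have "c (act g p) = c (act h p)"
      using fun_cong[OF gh, of p] p(1) by (simp add: \<phi>_def)
    then have "(act g p, act h p) \<in> R"
      using c P(2) p(1) Y R_sym R_trans by (metis subsetD)
    then show ?thesis
      using R_act[OF p(2)] R_sym R_trans by blast
  qed
  define K where "K = inv \<phi> ` range \<phi>"
  have "g \<in> uminus ` K + A" for g
  proof -
    \<comment> \<open>\<open>k\<close> is the chosen group element acting on the classes like
      \<open>- g\<close>, so \<open>k + g\<close> acts trivially and
      \<open>g = - k + (k + g)\<close>.\<close>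
    define k where "k = inv \<phi> (\<phi> (- g))"
    have "k \<in> K"
      by (simp add: k_def K_def)
    have "\<phi> (- g) = \<phi> k"
      by (simp add: k_def f_inv_into_f)
    then have "(y, act (k + g) y) \<in> R" if "y \<in> Y" for y
      using same[of "- g" k "act g y"] Y that by (simp add: act_add)
    then have "k + g \<in> A"
      by (simp add: A_def)
    then have "- k + (k + g) \<in> uminus ` K + A"
      using \<open>k \<in> K\<close> by blast
    then show ?thesis
      by (simp add: add.assoc[symmetric])
  qed
  then show "syndetic A"
    unfolding syndetic_def using fin by (intro exI[of _ K]) (auto simp: K_def)
qed

lemma distal_zero_dimensional_regularly_almost_periodic:
  assumes "distal act" "compactly_generated TYPE('g)"
    and Y: "compact Y" "\<And>t y. y \<in> Y \<Longrightarrow> act t y \<in> Y" "zero_dimensional_space (top_of_set Y)"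
  shows "regularly_almost_periodic_on act Y"
  unfolding regularly_almost_periodic_on_def
proof (intro allI impI)
  fix \<beta> :: "('x \<times> 'x) set"
  assume "\<forall>\<^sub>F p in uniformity_on Y. p \<in> \<beta>"
  then obtain \<alpha> where \<alpha>: "equiv Y \<alpha>" "\<alpha> \<subseteq> \<beta>" "closed \<alpha>" "closed (Y \<times> Y - \<alpha>)"
    using zero_dimensional_clopen_equiv[OF Y(1,3)] by metis
  have \<alpha>Y: "\<alpha> \<subseteq> Y \<times> Y"
    by (rule equiv_type[OF \<alpha>(1)])
  define R where "R = {q. \<forall>g. act2 g q \<in> \<alpha>}"
  obtain \<Gamma> :: "'g set" where "compact \<Gamma>" "0 \<in> \<Gamma>" "\<Gamma> = uminus ` \<Gamma>"
    "UNIV = (\<Union>r\<in>{1..}. ((+) \<Gamma> ^^ r) {0})"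
    using assms(2) unfolding compactly_generated_def by blast
  then have cl: "closed (Y \<times> Y - R)"
    unfolding R_def using open_invariant_core[OF assms(1) _ _ _ _ Y(1,2) \<alpha>Y \<alpha>(3,4)] by blast
  have R\<alpha>: "R \<subseteq> \<alpha>"
  proof
    fix q
    assume "q \<in> R"
    then have "act2 0 q \<in> \<alpha>"
      unfolding R_def by blast
    then show "q \<in> \<alpha>"
      by simp
  qed
  have R_inv: "act2 g q \<in> R" if "q \<in> R" for g q
    using that by (simp add: R_def flip: act2_add)
  have R_equiv: "equiv Y R"
  proof (intro equivI)
    show "R \<subseteq> Y \<times> Y"
      using R\<alpha> \<alpha>Y by blast
    show "refl_on Y R"
      using \<alpha>(1) Y(2) by (auto simp: refl_on_def R_def act2_def equiv_def)
    show "sym R"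
      using \<alpha>(1) by (auto simp: R_def act2_def equiv_def sym_def)
    show "trans R"
      using \<alpha>(1) by (auto simp: R_def act2_def equiv_def trans_def) blast
  qed
  \<comment> \<open>For \<open>y\<close> in \<open>Y\<close>, the trace of this open set on
    \<open>Y\<close> is the class of \<open>y\<close>; a finite subcover therefore supplies
    representatives of all classes.\<close>
  have "open {z. (y, z) \<notin> Y \<times> Y - R}" for y
  proof -
    have "continuous_on UNIV (\<lambda>z. (y, z))"
      by (intro continuous_intros)
    from closed_vimage[OF cl this] show ?thesis
      by (simp add: closed_def vimage_def Compl_eq Collect_neg_eq)
  qed
  moreover have "Y \<subseteq> (\<Union>y\<in>Y. {z. (y, z) \<notin> Y \<times> Y - R})"
    using R_equiv by (auto simp: equiv_def dest: refl_onD)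
  ultimately obtain P where P: "P \<subseteq> Y" "finite P" "Y \<subseteq> (\<Union>p\<in>P. {z. (p, z) \<notin> Y \<times> Y - R})"
    using compactE_image[OF Y(1), of Y] by metis
  then have "\<exists>p\<in>P. (p, y) \<in> R" if "y \<in> Y" for y
    using that by blast
  note kernel = kernel_of_finite_quotient[OF Y(2) R_equiv R_inv P(2,1) this]
  show "\<exists>A. normal_subgroup A \<and> syndetic A \<and>
             (\<forall>y\<in>Y. (\<lambda>t. act t y) ` A \<subseteq> {z. (y, z) \<in> \<beta>})"
    using kernel R\<alpha> \<alpha>(2) by (intro exI[of _ "{t. \<forall>y\<in>Y. (y, act t y) \<in> R}"]) auto
qed

end

section \<open>From orbit closures to points\<close>

text \<open>A neighbourhood \<open>U\<close> of \<open>x\<close> becomes an index that constrains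
  only the pairs with first entry \<open>x\<close>; uniform regularity for this index, read at
  \<open>x\<close>, is the claim.\<close>

lemma regularly_almost_periodic_on_imp_point:
  assumes "regularly_almost_periodic_on act Y" "x \<in> Y" "\<And>t. act t x \<in> Y"
  shows "regularly_almost_periodic_point act x"
  unfolding regularly_almost_periodic_point_def
proof (intro allI impI)
  fix U
  assume "\<forall>\<^sub>F y in nhds x. y \<in> U"
  then have "\<forall>\<^sub>F p in uniformity. p \<in> {(a, b). a = x \<longrightarrow> b \<in> U}"
    by (simp add: eventually_nhds_uniformity case_prod_unfold)
  then have "\<forall>\<^sub>F p in uniformity_on Y. p \<in> {(a, b). a = x \<longrightarrow> b \<in> U}"
    by (auto simp: eventually_inf_principal elim: eventually_mono)
  then obtain A where "normal_subgroup A" "syndetic A"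
    "\<forall>y\<in>Y. (\<lambda>t. act t y) ` A \<subseteq> {z. (y, z) \<in> {(a, b). a = x \<longrightarrow> b \<in> U}}"
    using assms(1) unfolding regularly_almost_periodic_on_def by blast
  then show "\<exists>A. normal_subgroup A \<and> syndetic A \<and> A \<subseteq> {t. act t x \<in> U}"
    using assms(2) by blast
qed

theorem theorem4p1p3:
  fixes act :: "'g::{group_add, topological_monoid_add, t2_space} \<Rightarrow>
                'x::{uniform_space, t2_space} \<Rightarrow> 'x"
  assumes "flow act"
    and "distal act"
    and "compactly_generated TYPE('g)"
    and "\<And>x. zero_dimensional_space (top_of_set (orbit_closure act x))"
  shows "pointwise_regularly_almost_periodic act \<and>
         (\<forall>x. subflow act (orbit_closure act x) \<and>
              regularly_almost_periodic_on act (orbit_closure act x))"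
proof -
  interpret flow act
    by (rule assms(1))
  have rap: "regularly_almost_periodic_on act (orbit_closure act x)" for x
    by (rule distal_zero_dimensional_regularly_almost_periodic[OF assms(2,3)
          compact_orbit_closure act_orbit_closure assms(4)])
  then have "pointwise_regularly_almost_periodic act"
    unfolding pointwise_regularly_almost_periodic_def
    using regularly_almost_periodic_on_imp_point orbit_closure_self act_orbit_closure by metis
  moreover have "subflow act (orbit_closure act x)" for x
    using orbit_closure_self act_orbit_closure by (auto simp: subflow_def)
  ultimately show ?thesis
    using rap by blast
qed

end
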